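(* Let $0 < \varepsilon \le \frac{1}{10}$ and $0 < \beta \le \frac{\varepsilon}{9}$. The algorithm $\mathcal{ALG}^\varepsilon_{PS}$, with first output $\mathcal{ALG}_1(S) = W'_S$ and second output $\mathcal{ALG}_2(S) = w(\hat{M}(S))$, is an $\bigl(\mathsf{MWM}, 2+2\varepsilon, 3+20\varepsilon, \beta\bigr)$-refined lookahead algorithm. That is, for every stream $S$ of weighted edges, $W'_S \le \mathsf{MWM}(S) \le (2+2\varepsilon) W'_S$, and for every partition $S = ABC$ into consecutive substreams with $W'_B \ge (1-\beta) W'_{AB}$, we have $w(\hat{M}(BC)) \le \mathsf{MWM}(ABC) \le (3+20\varepsilon)\cdot w(\hat{M}(BC))$.
   Context: A stream is a sequence of edges on a vertex set $V$, each edge $e$ with weight $w(e)>0$; $AB$, $ABC$ denote concatenations of streams; $w(F)=\sum_{e\in F} w(e)$ and $\mathsf{MWM}(S)$ is the maximum weight of a matching in the graph formed by the edges of $S$. Algorithm $\mathcal{ALG}^\varepsilon_{PS}$ on a stream $S$: initialize an empty stack and potentials $\varphi(v) = 0$ for all $v\in V$. When edge $e=\{u,v\}$ arrives: if $w(e) < (1+\varepsilon)(\varphi(u)+\varphi(v))$, set $w'(e)=0$; otherwise set $w'(e) = w(e) - (\varphi(u)+\varphi(v))$, increase both $\varphi(u)$ and $\varphi(v)$ by $w'(e)$, and push $e$ on the stack. Then, for each $x\in\{u,v\}$, if $x$ is incident to more than $\frac{3\log(1/\varepsilon)}{\varepsilon}+1$ edges in the stack, remove the oldest stack edge incident to $x$.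 After the stream ends, pop the stack edges one by one, adding each popped edge to an initially empty matching $\hat{M}$ whenever $\hat{M}$ stays a matching; $\hat{M}(S)$ is the result. $w'_S(e)$ denotes the value $w'(e)$ (reduced weight) computed in the run on $S$, and $W'_S = \sum_{e\in S} w'_S(e)$. An $(f,\alpha_1,\alpha_2,\beta)$-refined lookahead algorithm is a streaming algorithm with two outputs $\mathcal{ALG}_1,\mathcal{ALG}_2$ such that for every stream $S$: (1) $\mathcal{ALG}_1(S)\le f(S)\le \alpha_1 \mathcal{ALG}_1(S)$, and (2) for every partition $S=ABC$ with $\mathcal{ALG}_1(B)\ge(1-\beta)\mathcal{ALG}_1(AB)$, $\mathcal{ALG}_2(BC)\le f(ABC)\le\alpha_2\mathcal{ALG}_2(BC)$. *)

theory Defs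
  imports Complex_Main
begin

text \<open>A stream item \<open>(u, v, w)\<close> is the edge \<open>{u, v}\<close> with weight \<open>w\<close>. The order in which the
  endpoints are listed only fixes the order in which the algorithm visits them when it trims the
  stack. Repeated and parallel edges are allowed.\<close>

type_synonym 'v wedge = "'v \<times> 'v \<times> real"

fun ends :: "'v wedge \<Rightarrow> 'v set" where
  "ends (u, v, w) = {u, v}"

fun wt :: "'v wedge \<Rightarrow> real" where
  "wt (u, v, w) = w"

definition is_stream :: "'v wedge list \<Rightarrow> bool" where
  "is_stream S \<longleftrightarrow> (\<forall>(u, v, w) \<in> set S. u \<noteq> v \<and> w > 0)"

definition is_matching :: "'v wedge set \<Rightarrow> bool" where
  "is_matching M \<longleftrightarrow> (\<forall>e\<in>M. \<forall>e'\<in>M. e \<noteq> e' \<longrightarrow> ends e \<inter> ends e' = {})"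

definition weight :: "'v wedge set \<Rightarrow> real" where
  "weight F = (\<Sum>e\<in>F. wt e)"

definition MWM :: "'v wedge list \<Rightarrow> real" where
  "MWM S = Max (weight ` {M. M \<subseteq> set S \<and> is_matching M})"

text \<open>The stack is listed from the oldest edge to the most recent one; \<open>rweights\<close> records the
  reduced weights of all edges seen so far, in order of arrival.\<close>

record 'v ps_state =
  pot :: "'v \<Rightarrow> real"
  stack :: "'v wedge list"
  rweights :: "real list"

definition ps_init :: "'v ps_state" where
  "ps_init = \<lparr>pot = (\<lambda>_. 0), stack = [], rweights = []\<rparr>"

definition remove_oldest :: "'v \<Rightarrow> 'v wedge list \<Rightarrow> 'v wedge list" where
  "remove_oldest x st =
     takeWhile (\<lambda>e. x \<notin> ends e) st @ tl (dropWhile (\<lambda>e. x \<notin> ends e) st)"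

definition trim :: "real \<Rightarrow> 'v \<Rightarrow> 'v wedge list \<Rightarrow> 'v wedge list" where
  "trim \<epsilon> x st =
     (if real (length (filter (\<lambda>e. x \<in> ends e) st)) > 3 * ln (1 / \<epsilon>) / \<epsilon> + 1
      then remove_oldest x st else st)"

fun ps_step :: "real \<Rightarrow> 'v ps_state \<Rightarrow> 'v wedge \<Rightarrow> 'v ps_state" where
  "ps_step \<epsilon> \<sigma> (u, v, w) =
     (let \<phi> = pot \<sigma>;
          push = (\<not> w < (1 + \<epsilon>) * (\<phi> u + \<phi> v));
          w' = (if push then w - (\<phi> u + \<phi> v) else 0);
          \<phi>' = (if push then \<phi>(u := \<phi> u + w', v := \<phi> v + w') else \<phi>);
          st = (if push then stack \<sigma> @ [(u, v, w)] else stack \<sigma>)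
      in \<lparr>pot = \<phi>', stack = trim \<epsilon> v (trim \<epsilon> u st), rweights = rweights \<sigma> @ [w']\<rparr>)"

definition ps_run :: "real \<Rightarrow> 'v wedge list \<Rightarrow> 'v ps_state" where
  "ps_run \<epsilon> S = foldl (ps_step \<epsilon>) ps_init S"

definition reduced_total :: "real \<Rightarrow> 'v wedge list \<Rightarrow> real" where
  "reduced_total \<epsilon> S = sum_list (rweights (ps_run \<epsilon> S))"

text \<open>\<open>foldr\<close> processes the stack from its last, i.e. most recent, element.\<close>

definition ps_matching :: "real \<Rightarrow> 'v wedge list \<Rightarrow> 'v wedge set" where
  "ps_matching \<epsilon> S =
     foldr (\<lambda>e M. if is_matching (insert e M) then insert e M else M) (stack (ps_run \<epsilon> S)) {}"

text \<open>The algorithm is given by its two outputs; \<open>valid\<close> singles out the admissible streams.\<close>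

definition refined_lookahead ::
  "('a list \<Rightarrow> bool) \<Rightarrow> ('a list \<Rightarrow> real) \<Rightarrow> real \<Rightarrow> real \<Rightarrow> real
    \<Rightarrow> ('a list \<Rightarrow> real) \<Rightarrow> ('a list \<Rightarrow> real) \<Rightarrow> bool" where
  "refined_lookahead valid f \<alpha>1 \<alpha>2 \<beta> ALG1 ALG2 \<longleftrightarrow>
     (\<forall>S. valid S \<longrightarrow>
        ALG1 S \<le> f S \<and> f S \<le> \<alpha>1 * ALG1 S \<and>
        (\<forall>A B C. S = A @ B @ C \<and> ALG1 B \<ge> (1 - \<beta>) * ALG1 (A @ B) \<longrightarrow>
           ALG2 (B @ C) \<le> f (A @ B @ C) \<and> f (A @ B @ C) \<le> \<alpha>2 * ALG2 (B @ C)))"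

end

theory Submission
  imports Defs "HOL-Library.Sublist"
begin

text \<open>Write \<open>\<phi>\<^sub>S\<close> for the final potentials on \<open>S\<close>, so that \<open>\<Sum>\<phi>\<^sub>S = 2 W'\<^sub>S\<close>. Every edge \<open>{u, v}\<close>
  of \<open>S\<close> weighs at most \<open>(1 + \<epsilon>) (\<phi>\<^sub>S u + \<phi>\<^sub>S v)\<close>. Conversely, a pushed edge weighs as much as its
  own reduced weight plus, for each endpoint, the reduced weights of the earlier pushed edges there.
  Hence unwinding any subsequence of the pushed edges greedily from the end yields a matching at
  least as heavy as the sum of the reduced weights in it. Potentials grow by a factor \<open>1 + \<epsilon>\<close> at
  each push, so a trimmed edge has at most \<open>\<epsilon>\<close> times the reduced weight of the edge whose push
  expels it. A push expels at most two edges, so \<open>w(M) \<ge> (1 - 2 \<epsilon>) W'\<^sub>S\<close> for the output matching \<open>M\<close>.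

  For the lookahead bound split an optimal matching of \<open>ABC\<close> into its edges outside \<open>BC\<close>, covering
  the vertices \<open>X\<close>, and its edges in \<open>BC\<close>, covering \<open>Y\<close>. Its weight is at most
  \<open>(1 + \<epsilon>) (\<phi>\<^bsub>AB\<^esub>(X) + \<phi>\<^bsub>BC\<^esub>(Y))\<close>. Unwinding only the pushed edges of \<open>B\<close> that avoid \<open>X\<close> gives a
  matching of weight at least \<open>W'\<^sub>B - \<phi>\<^sub>B(X)\<close>. Its vertices carry at most \<open>2 W'\<^bsub>AB\<^esub> - \<phi>\<^bsub>AB\<^esub>(X)\<close> of
  \<open>\<phi>\<^bsub>AB\<^esub>\<close>, so \<open>(1 + \<epsilon>) \<phi>\<^bsub>AB\<^esub>(X) \<le> 2 (1 + \<epsilon>) W'\<^bsub>AB\<^esub> - W'\<^sub>B + \<phi>\<^sub>B(X)\<close>. Since \<open>\<phi>\<^sub>B \<le> \<phi>\<^bsub>BC\<^esub>\<close> and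
  \<open>W'\<^bsub>AB\<^esub> \<approx> W'\<^sub>B \<le> W'\<^bsub>BC\<^esub>\<close>, the total is about \<open>2 W'\<^bsub>AB\<^esub> - W'\<^sub>B + 2 W'\<^bsub>BC\<^esub> \<le> 3 W'\<^bsub>BC\<^esub>\<close>.\<close>

section \<open>Edges and matchings\<close>

abbreviation verts :: "'v wedge set \<Rightarrow> 'v set" where
  "verts M \<equiv> \<Union>(ends ` M)"

lemma finite_ends [simp]: "finite (ends e)"
  by (cases e) auto

lemma ends_nonempty: "ends e \<noteq> {}"
  by (cases e) auto

lemma card_ends_le: "card (ends e) \<le> 2"
  by (cases e) (simp add: card_insert_if)

lemma is_matching_empty [simp]: "is_matching {}"
  by (simp add: is_matching_def)

lemma is_matching_subset: "is_matching M \<Longrightarrow> N \<subseteq> M \<Longrightarrow> is_matching N"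
  unfolding is_matching_def by blast

lemma is_matching_insert:
  "is_matching (insert e M) \<longleftrightarrow> is_matching M \<and> (e \<in> M \<or> ends e \<inter> verts M = {})"
proof -
  have "ends e \<inter> verts M = {} \<longleftrightarrow> (\<forall>f\<in>M. ends e \<inter> ends f = {})"
    by (simp only: Int_UN_distrib SUP_bot_conv)
  then show ?thesis unfolding is_matching_def by (metis Int_commute insert_iff)
qed

lemma is_matching_verts_disjoint:
  assumes "is_matching M" "L \<subseteq> M" "N \<subseteq> M" "L \<inter> N = {}"
  shows "verts L \<inter> verts N = {}"
proof -
  have "ends e \<inter> ends f = {}" if "e \<in> L" "f \<in> N" for e f
  proof -
    have "e \<in> M" "f \<in> M" "e \<noteq> f" using that assms(2-4) by auto
    then show ?thesis using assms(1) by (simp add: is_matching_def)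
  qed
  then show ?thesis by blast
qed

lemma finite_verts: "M \<subseteq> set S \<Longrightarrow> finite (verts M)"
  using finite_subset[of M "set S"] by simp

lemma sum_verts_matching:
  assumes "finite M" "is_matching M"
  shows "sum \<phi> (verts M) = (\<Sum>e\<in>M. sum \<phi> (ends e))"
  using assms by (intro sum.UNION_disjoint) (auto simp: is_matching_def)

lemma finite_matchings: "finite {M. M \<subseteq> set S \<and> is_matching M}"
  by (rule finite_subset[of _ "Pow (set S)"]) auto

lemma weight_le_MWM: "M \<subseteq> set S \<Longrightarrow> is_matching M \<Longrightarrow> weight M \<le> MWM S"
  unfolding MWM_def using finite_matchings by (intro Max_ge) auto

lemma MWM_le:
  assumes "\<And>M. M \<subseteq> set S \<Longrightarrow> is_matching M \<Longrightarrow> weight M \<le> b"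
  shows "MWM S \<le> b"
proof -
  have "{} \<in> {M. M \<subseteq> set S \<and> is_matching M}" by simp
  then have "weight ` {M. M \<subseteq> set S \<and> is_matching M} \<noteq> {}" by blast
  then show ?thesis
    unfolding MWM_def using finite_matchings assms by (subst Max_le_iff) auto
qed

section \<open>Pushes with reduced weights\<close>

lemma list_pair_induct [case_names Nil Cons]:
  assumes "P []" "\<And>x y xs. P xs \<Longrightarrow> P ((x, y) # xs)"
  shows "P xs"
  using assms by (induction xs) auto

lemma le_mult_card:
  fixes r :: real
  assumes "0 \<le> r" "finite A" "A \<noteq> {}"
  shows "r \<le> r * card A"
proof -
  have "r * 1 \<le> r * card A"
    using assms by (intro mult_left_mono) (auto simp: Suc_le_eq card_gt_0_iff)
  then show ?thesis by simp
qed

abbreviation total_reduction :: "('v wedge \<times> real) list \<Rightarrow> real" where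
  "total_reduction T \<equiv> sum_list (map snd T)"

definition raise :: "'v wedge \<times> real \<Rightarrow> ('v \<Rightarrow> real) \<Rightarrow> 'v \<Rightarrow> real" where
  "raise p \<phi> x = \<phi> x + (if x \<in> ends (fst p) then snd p else 0)"

lemma raise_mono: "\<phi> \<le> \<psi> \<Longrightarrow> raise p \<phi> \<le> raise p \<psi>"
  by (simp add: le_fun_def raise_def)

lemma le_raise: "0 \<le> snd p \<Longrightarrow> \<phi> \<le> raise p \<phi>"
  by (simp add: le_fun_def raise_def)

lemma sum_raise:
  assumes "finite X"
  shows "sum (raise (e, r) \<phi>) X = sum \<phi> X + r * card (ends e \<inter> X)"
  using assms by (simp add: raise_def sum.distrib sum.If_cases Int_commute)

lemma le_fold_raise: "\<forall>p\<in>set T. 0 \<le> snd p \<Longrightarrow> \<phi> \<le> fold raise T \<phi>"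
  by (induction T arbitrary: \<phi>) (auto intro: order.trans le_raise)

lemma sum_fold_raise:
  fixes \<phi> :: "'v \<Rightarrow> real" and T :: "('v wedge \<times> real) list"
  assumes "finite X"
  shows "sum (fold raise T \<phi>) X = sum \<phi> X + (\<Sum>(e, r)\<leftarrow>T. r * card (ends e \<inter> X))"
proof (induction T arbitrary: \<phi> rule: list_pair_induct)
  case (Cons e r T)
  then show ?case by (simp add: sum_raise[OF assms])
qed simp

lemma sum_fold_raise_le_total_reduction:
  assumes "finite X" "\<forall>p\<in>set T. 0 \<le> snd p"
  shows "sum (fold raise T (\<lambda>_. 0)) X \<le> 2 * total_reduction T"
proof -
  have card: "card (ends e \<inter> X) \<le> 2" for e :: "'a wedge"
    using card_mono[of "ends e" "ends e \<inter> X"] card_ends_le[of e] by simp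
  have "(\<Sum>(e, r)\<leftarrow>T. r * card (ends e \<inter> X)) \<le> (\<Sum>p\<leftarrow>T. 2 * snd p)"
  proof (rule sum_list_mono)
    fix p assume "p \<in> set T"
    then have "snd p * card (ends (fst p) \<inter> X) \<le> snd p * 2"
      using assms(2) card[of "fst p"] by (intro mult_left_mono) auto
    then show "(case p of (e, r) \<Rightarrow> r * card (ends e \<inter> X)) \<le> 2 * snd p"
      by (simp add: case_prod_beta mult.commute)
  qed
  then show ?thesis by (simp add: sum_fold_raise assms(1) sum_list_const_mult)
qed

lemma total_reduction_le_avoiding:
  assumes "finite X" "\<forall>p\<in>set T. 0 \<le> snd p"
  shows "total_reduction T
           \<le> total_reduction (filter (\<lambda>(e, r). ends e \<inter> X = {}) T) + sum (fold raise T (\<lambda>_. 0)) X"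
proof -
  have "total_reduction T
      \<le> total_reduction (filter (\<lambda>(e, r). ends e \<inter> X = {}) T) + (\<Sum>(e, r)\<leftarrow>T. r * card (ends e \<inter> X))"
    using assms(2)
  proof (induction T rule: list_pair_induct)
    case (Cons e r T)
    show ?case
    proof (cases "ends e \<inter> X = {}")
      case True
      then show ?thesis using Cons by simp
    next
      case False
      then have "r \<le> r * card (ends e \<inter> X)"
        using Cons.prems by (intro le_mult_card) auto
      then show ?thesis using False Cons by simp
    qed
  qed simp
  then show ?thesis by (simp add: sum_fold_raise assms(1))
qed

text \<open>Starting from the potentials \<open>\<phi>\<close>, the edges \<open>e\<close> are pushed with reduced weights \<open>r\<close>. Only
  inequalities are imposed, which makes the notion stable under passing to subsequences: that only
  lowers the potentials.\<close>

fun charged :: "real \<Rightarrow> ('v \<Rightarrow> real) \<Rightarrow> ('v wedge \<times> real) list \<Rightarrow> bool" where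
  "charged \<epsilon> \<phi> [] \<longleftrightarrow> True"
| "charged \<epsilon> \<phi> ((e, r) # T) \<longleftrightarrow>
     0 \<le> r \<and> \<epsilon> * sum \<phi> (ends e) \<le> r \<and> r + sum \<phi> (ends e) \<le> wt e \<and> charged \<epsilon> (raise (e, r) \<phi>) T"

lemma charged_append:
  "charged \<epsilon> \<phi> (T @ T') \<longleftrightarrow> charged \<epsilon> \<phi> T \<and> charged \<epsilon> (fold raise T \<phi>) T'"
  by (induction T arbitrary: \<phi> rule: list_pair_induct) simp_all

lemma charged_nonneg: "charged \<epsilon> \<phi> T \<Longrightarrow> \<forall>p\<in>set T. 0 \<le> snd p"
proof (induction T arbitrary: \<phi> rule: list_pair_induct)
  case (Cons e r T)
  then show ?case using Cons.IH[of "raise (e, r) \<phi>"] by simp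
qed simp

lemma charged_antimono:
  assumes "charged \<epsilon> \<phi> T" "\<psi> \<le> \<phi>" "0 \<le> \<epsilon>"
  shows "charged \<epsilon> \<psi> T"
  using assms
proof (induction T arbitrary: \<phi> \<psi> rule: list_pair_induct)
  case (Cons e r T)
  have sum_le: "sum \<psi> (ends e) \<le> sum \<phi> (ends e)"
    using Cons.prems by (intro sum_mono) (simp add: le_fun_def)
  then have "\<epsilon> * sum \<psi> (ends e) \<le> \<epsilon> * sum \<phi> (ends e)"
    using Cons.prems by (intro mult_left_mono)
  moreover have "charged \<epsilon> (raise (e, r) \<psi>) T"
    using Cons.prems Cons.IH[OF _ raise_mono[OF Cons.prems(2)], of "(e, r)"] by simp
  ultimately show ?case using sum_le Cons.prems by simp
qed simp

lemma charged_subseq: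
  assumes "subseq T' T" "charged \<epsilon> \<phi> T" "0 \<le> \<epsilon>"
  shows "charged \<epsilon> \<phi> T'"
  using assms
proof (induction arbitrary: \<phi> rule: list_emb.induct)
  case (list_emb_Cons T' T p)
  have "0 \<le> snd p" "charged \<epsilon> (raise p \<phi>) T'"
    using list_emb_Cons by (cases p; simp)+
  then show ?case
    using charged_antimono le_raise list_emb_Cons.prems(2) by blast
next
  case (list_emb_Cons2 p q T' T)
  then show ?case by (cases p) auto
qed simp

section \<open>Greedy matchings\<close>

definition greedy :: "'v wedge list \<Rightarrow> 'v wedge set" where
  "greedy st = foldr (\<lambda>e M. if is_matching (insert e M) then insert e M else M) st {}"

lemma greedy_subset: "greedy st \<subseteq> set st"
  by (induction st) (auto simp: greedy_def)

lemma finite_greedy [simp]: "finite (greedy st)"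
  using finite_subset[OF greedy_subset] by blast

lemma is_matching_greedy: "is_matching (greedy st)"
  by (induction st) (simp_all add: greedy_def)

lemma greedy_Nil [simp]: "greedy [] = {}"
  by (simp add: greedy_def)

lemma greedy_Cons:
  "greedy (e # st) =
     (if ends e \<inter> verts (greedy st) = {} then insert e (greedy st) else greedy st)"
proof -
  have "greedy (e # st) =
      (if is_matching (insert e (greedy st)) then insert e (greedy st) else greedy st)"
    by (simp add: greedy_def)
  also have "\<dots> = (if ends e \<inter> verts (greedy st) = {} then insert e (greedy st) else greedy st)"
    using is_matching_greedy[of st] by (auto simp: is_matching_insert insert_absorb)
  finally show ?thesis .
qed

lemma charged_greedy_weight:
  assumes "charged \<epsilon> \<phi> T"
  shows "total_reduction T + sum \<phi> (verts (greedy (map fst T))) \<le> weight (greedy (map fst T))"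
  using assms
proof (induction T arbitrary: \<phi> rule: list_pair_induct)
  case Nil
  then show ?case by (simp add: weight_def)
next
  case (Cons e r T)
  let ?M = "greedy (map fst T)"
  have finite_V: "finite (verts ?M)" by simp
  have IH: "total_reduction T + sum \<phi> (verts ?M) + r * card (ends e \<inter> verts ?M) \<le> weight ?M"
    using Cons.IH[of "raise (e, r) \<phi>"] Cons.prems sum_raise[OF finite_V, of e r \<phi>] by simp
  show ?case
  proof (cases "ends e \<inter> verts ?M = {}")
    case True
    then have "e \<notin> ?M" using ends_nonempty[of e] by blast
    moreover have "sum \<phi> (ends e \<union> verts ?M) = sum \<phi> (ends e) + sum \<phi> (verts ?M)"
      using True finite_V by (intro sum.union_disjoint) auto
    ultimately show ?thesis
      using True IH Cons.prems by (simp add: greedy_Cons weight_def)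
  next
    case False
    then have "r \<le> r * card (ends e \<inter> verts ?M)"
      using Cons.prems by (intro le_mult_card) auto
    then show ?thesis using False IH by (simp add: greedy_Cons)
  qed
qed

section \<open>Trimming\<close>

abbreviation degree :: "'v \<Rightarrow> 'v wedge list \<Rightarrow> nat" where
  "degree x st \<equiv> length (filter (\<lambda>e. x \<in> ends e) st)"

abbreviation max_degree :: "real \<Rightarrow> real" where
  "max_degree \<epsilon> \<equiv> 3 * ln (1 / \<epsilon>) / \<epsilon> + 1"

fun trim_ends :: "real \<Rightarrow> 'v wedge \<Rightarrow> 'v wedge list \<Rightarrow> 'v wedge list" where
  "trim_ends \<epsilon> (u, v, w) st = trim \<epsilon> v (trim \<epsilon> u st)"

lemma max_degree_ge_1: "0 < \<epsilon> \<Longrightarrow> \<epsilon> \<le> 1 \<Longrightarrow> 1 \<le> max_degree \<epsilon>"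
  by simp

lemma remove_oldest_append:
  "degree x st = 0 \<Longrightarrow> x \<in> ends e \<Longrightarrow> remove_oldest x (st @ e # st') = st @ st'"
  by (induction st) (simp_all add: remove_oldest_def split: if_splits)

lemma trim_cases [consumes 2]:
  assumes "0 < \<epsilon>" "\<epsilon> \<le> 1"
  obtains (keep) "real (degree x st) \<le> max_degree \<epsilon>" "trim \<epsilon> x st = st"
  | (drop) st1 e st2 where "max_degree \<epsilon> < real (degree x st)" "st = st1 @ e # st2"
      "degree x st1 = 0" "x \<in> ends e" "trim \<epsilon> x st = st1 @ st2"
proof (cases "max_degree \<epsilon> < real (degree x st)")
  case False
  then show ?thesis using keep by (simp add: trim_def)
next
  case True
  then have "degree x st \<noteq> 0" using max_degree_ge_1[OF assms] by linarith
  then have "\<exists>e\<in>set st. x \<in> ends e" by (auto simp: filter_empty_conv)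
  from split_list_first_prop[OF this] obtain st1 e st2
    where "st = st1 @ e # st2" "x \<in> ends e" "\<forall>f\<in>set st1. x \<notin> ends f" by blast
  moreover from this have "degree x st1 = 0" by (simp add: filter_empty_conv)
  ultimately show ?thesis
    using True remove_oldest_append[of x st1 e st2] by (intro drop) (auto simp: trim_def)
qed

lemma degree_trim_le:
  assumes "0 < \<epsilon>" "\<epsilon> \<le> 1"
  shows "degree y (trim \<epsilon> x st) \<le> degree y st"
  using assms by (cases rule: trim_cases[of \<epsilon> x st]) auto

lemma degree_trim:
  assumes "0 < \<epsilon>" "\<epsilon> \<le> 1" "real (degree x st) \<le> max_degree \<epsilon> + 1"
  shows "real (degree x (trim \<epsilon> x st)) \<le> max_degree \<epsilon>"
  using assms(1,2)
proof (cases rule: trim_cases[of \<epsilon> x st])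
  case (drop st1 e st2)
  then show ?thesis using assms(3) by simp
qed simp

lemma degree_trim_ends_le:
  assumes "0 < \<epsilon>" "\<epsilon> \<le> 1"
  shows "degree x (trim_ends \<epsilon> e st) \<le> degree x st"
proof (cases e)
  case (fields u v w)
  then show ?thesis
    using degree_trim_le[OF assms, of x v "trim \<epsilon> u st"] degree_trim_le[OF assms, of x u st] by simp
qed

lemma degree_trim_ends:
  assumes "0 < \<epsilon>" "\<epsilon> \<le> 1" "real (degree x st) \<le> max_degree \<epsilon> + 1" "x \<in> ends e"
  shows "real (degree x (trim_ends \<epsilon> e st)) \<le> max_degree \<epsilon>"
proof -
  obtain u v w where e: "e = (u, v, w)" by (cases e)
  have trim_le: "degree x (trim \<epsilon> y st') \<le> degree x st'" for y st'
    using degree_trim_le[OF assms(1,2)] .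
  have "real (degree x (trim \<epsilon> x (trim \<epsilon> u st))) \<le> max_degree \<epsilon>"
    using trim_le[of u st] assms(3) by (intro degree_trim assms(1,2)) linarith
  moreover have "real (degree x (trim \<epsilon> v (trim \<epsilon> x st))) \<le> max_degree \<epsilon>"
    using trim_le[of v "trim \<epsilon> x st"] degree_trim[OF assms(1-3)] by linarith
  ultimately show ?thesis using e assms(4) by auto
qed

lemma trim_ends_idle:
  assumes "\<forall>x. real (degree x st) \<le> max_degree \<epsilon>"
  shows "trim_ends \<epsilon> e st = st"
proof -
  have "trim \<epsilon> x st = st" for x using spec[OF assms, of x] by (simp add: trim_def)
  then show ?thesis by (cases e) simp
qed

lemma charged_potential_growth:
  assumes "charged \<epsilon> \<phi> T" "(\<lambda>_. 0) \<le> \<phi>" "0 \<le> \<epsilon>"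
  shows "(1 + \<epsilon>) ^ degree x (map fst T) * \<phi> x \<le> fold raise T \<phi> x"
  using assms
proof (induction T arbitrary: \<phi> rule: list_pair_induct)
  case (Cons e r T)
  let ?k = "(1 + \<epsilon>) ^ degree x (map fst T)"
  have IH: "?k * raise (e, r) \<phi> x \<le> fold raise T (raise (e, r) \<phi>) x"
    using Cons.prems order.trans[OF Cons.prems(2) le_raise, of "(e, r)"] by (intro Cons.IH) auto
  show ?case
  proof (cases "x \<in> ends e")
    case True
    have "\<epsilon> * \<phi> x \<le> \<epsilon> * sum \<phi> (ends e)"
      using Cons.prems True by (intro mult_left_mono member_le_sum) (auto simp: le_fun_def)
    then have "(1 + \<epsilon>) * \<phi> x \<le> raise (e, r) \<phi> x"
      using Cons.prems True by (simp add: raise_def algebra_simps)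
    then have "?k * ((1 + \<epsilon>) * \<phi> x) \<le> ?k * raise (e, r) \<phi> x"
      using Cons.prems by (intro mult_left_mono) auto
    with IH True show ?thesis by (simp add: mult_ac)
  qed (use IH in \<open>simp add: raise_def[of _ _ x]\<close>)
qed simp

lemma charged_reduced_weight_growth:
  assumes "charged \<epsilon> \<phi> (T1 @ (f, s) # T2 @ [(e, r)])" "(\<lambda>_. 0) \<le> \<phi>" "0 \<le> \<epsilon>"
    and "x \<in> ends f" "x \<in> ends e"
  shows "\<epsilon> * (1 + \<epsilon>) ^ degree x (map fst T2) * s \<le> r"
proof -
  let ?k = "(1 + \<epsilon>) ^ degree x (map fst T2)"
  define \<phi>1 where "\<phi>1 = fold raise T1 \<phi>"
  define \<phi>2 where "\<phi>2 = raise (f, s) \<phi>1"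
  define \<phi>3 where "\<phi>3 = fold raise T2 \<phi>2"
  have T1: "charged \<epsilon> \<phi> T1" and s: "0 \<le> s" and T2: "charged \<epsilon> \<phi>2 T2"
    and e: "\<epsilon> * sum \<phi>3 (ends e) \<le> r"
    using assms(1) by (simp_all add: charged_append \<phi>1_def \<phi>2_def \<phi>3_def)
  have \<phi>1: "(\<lambda>_. 0) \<le> \<phi>1"
    using assms(2) le_fold_raise[OF charged_nonneg[OF T1]] unfolding \<phi>1_def by (rule order.trans)
  have \<phi>2: "(\<lambda>_. 0) \<le> \<phi>2"
    using \<phi>1 le_raise[of "(f, s)"] s unfolding \<phi>2_def by (auto intro: order.trans)
  have \<phi>3: "(\<lambda>_. 0) \<le> \<phi>3"
    using \<phi>2 le_fold_raise[OF charged_nonneg[OF T2]] unfolding \<phi>3_def by (rule order.trans)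
  have "?k * s \<le> ?k * \<phi>2 x"
    using assms(3,4) \<phi>1 by (intro mult_left_mono) (auto simp: \<phi>2_def raise_def le_fun_def)
  also have "\<dots> \<le> \<phi>3 x"
    unfolding \<phi>3_def using T2 \<phi>2 assms(3) by (intro charged_potential_growth)
  also have "\<phi>3 x \<le> sum \<phi>3 (ends e)"
    using assms(5) \<phi>3 by (intro member_le_sum) (auto simp: le_fun_def)
  finally have "\<epsilon> * (?k * s) \<le> \<epsilon> * sum \<phi>3 (ends e)"
    using assms(3) by (intro mult_left_mono)
  with e show ?thesis by (simp add: mult.assoc)
qed

lemma power_ge_beyond_max_degree:
  assumes "0 < \<epsilon>" "\<epsilon> \<le> 1 / 4" "max_degree \<epsilon> < n + 2"
  shows "1 \<le> \<epsilon>\<^sup>2 * (1 + \<epsilon>) ^ n"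
proof -
  let ?L = "ln (1 / \<epsilon>)"
  have L: "1 - \<epsilon> \<le> ?L"
    using ln_le_minus_one[of \<epsilon>] assms(1) by (simp add: ln_div)
  have "\<epsilon> * (1 - \<epsilon>) \<le> (1 - 3 * \<epsilon>) * (1 - \<epsilon>)"
    using assms(1,2) by (intro mult_right_mono) auto
  also have "\<dots> \<le> (1 - 3 * \<epsilon>) * ?L"
    using L assms(1,2) by (intro mult_left_mono) auto
  finally have "2 * ?L \<le> (3 * ?L - \<epsilon>) * (1 - \<epsilon>)" by (simp add: algebra_simps)
  also have "\<dots> \<le> (n * \<epsilon>) * (1 - \<epsilon>)"
    using assms by (intro mult_right_mono) (auto simp: field_simps)
  also have "\<dots> = n * (\<epsilon> - \<epsilon>\<^sup>2)" by (simp add: algebra_simps power2_eq_square)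
  also have "\<dots> \<le> n * ln (1 + \<epsilon>)"
    using ln_one_plus_pos_lower_bound[of \<epsilon>] assms(1,2) by (intro mult_left_mono) auto
  finally have "0 \<le> ln (\<epsilon>\<^sup>2 * (1 + \<epsilon>) ^ n)"
    using assms(1) by (simp add: ln_mult ln_realpow ln_div)
  then show ?thesis using assms(1) by (simp add: ln_ge_zero_iff)
qed

lemma charged_light_beyond_max_degree:
  assumes "0 < \<epsilon>" "\<epsilon> \<le> 1 / 4" "charged \<epsilon> \<phi> (T1 @ (f, s) # T2 @ [(e, r)])" "(\<lambda>_. 0) \<le> \<phi>"
    and "x \<in> ends f" "x \<in> ends e" "max_degree \<epsilon> < real (degree x (map fst T2)) + 2"
  shows "s \<le> \<epsilon> * r"
proof -
  let ?n = "degree x (map fst T2)"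
  have "0 \<le> s" using charged_nonneg[OF assms(3)] by simp
  then have "1 * s \<le> \<epsilon>\<^sup>2 * (1 + \<epsilon>) ^ ?n * s"
    using assms(1,2,7) by (intro mult_right_mono power_ge_beyond_max_degree)
  also have "\<dots> = \<epsilon> * (\<epsilon> * (1 + \<epsilon>) ^ ?n * s)" by (simp add: power2_eq_square mult_ac)
  also have "\<dots> \<le> \<epsilon> * r"
    using assms(1) charged_reduced_weight_growth[OF assms(3,4) _ assms(5,6)]
    by (intro mult_left_mono) auto
  finally show ?thesis by simp
qed

lemma trim_total_reduction_ge:
  assumes "0 < \<epsilon>" "\<epsilon> \<le> 1 / 4" "charged \<epsilon> \<phi> (T @ [(e, r)])" "(\<lambda>_. 0) \<le> \<phi>" "x \<in> ends e"
  obtains T' where "subseq T' T" "trim \<epsilon> x (map fst T @ [e]) = map fst T' @ [e]"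
    "total_reduction T - \<epsilon> * r \<le> total_reduction T'"
proof -
  have "\<epsilon> \<le> 1" using assms(2) by linarith
  from assms(1) this show ?thesis
  proof (cases rule: trim_cases[of \<epsilon> x "map fst T @ [e]"])
    case keep
    moreover have "0 \<le> \<epsilon> * r" using assms(1,3) by (simp add: charged_append)
    ultimately show ?thesis by (intro that[of T]) auto
  next
    case (drop st1 f st2)
    then have degree: "max_degree \<epsilon> < real (degree x st2) + 1" by simp
    then have "0 < degree x st2" using max_degree_ge_1[OF assms(1) \<open>\<epsilon> \<le> 1\<close>] by linarith
    then have "st2 \<noteq> []" by auto
    with drop(2) obtain st2' where st2: "st2 = st2' @ [e]" "map fst T = st1 @ f # st2'"
      by (cases st2 rule: rev_cases) auto
    then obtain T1 s T2 where T: "T = T1 @ (f, s) # T2" "st1 = map fst T1" "st2' = map fst T2"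
      by (auto simp: map_eq_append_conv map_eq_Cons_conv)
    have "charged \<epsilon> \<phi> (T1 @ (f, s) # T2 @ [(e, r)])" using assms(3) T(1) by simp
    from charged_light_beyond_max_degree[OF assms(1,2) this assms(4) drop(4) assms(5)]
    have light: "s \<le> \<epsilon> * r" using degree assms(5) st2(1) T by simp
    show ?thesis
    proof (rule that)
      show "subseq (T1 @ T2) T"
        unfolding T(1) by (intro list_emb_append_mono list_emb_Cons subseq_order.refl)
      show "trim \<epsilon> x (map fst T @ [e]) = map fst (T1 @ T2) @ [e]"
        using drop(5) st2(1) T by simp
      show "total_reduction T - \<epsilon> * r \<le> total_reduction (T1 @ T2)" using light T(1) by simp
    qed
  qed
qed

lemma trim_ends_total_reduction_ge:
  assumes "0 < \<epsilon>" "\<epsilon> \<le> 1 / 4" "charged \<epsilon> \<phi> (T @ [(e, r)])" "(\<lambda>_. 0) \<le> \<phi>"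
  obtains T' where "subseq T' T" "trim_ends \<epsilon> e (map fst T @ [e]) = map fst T' @ [e]"
    "total_reduction T - 2 * \<epsilon> * r \<le> total_reduction T'"
proof -
  obtain u v w where e: "e = (u, v, w)" by (cases e)
  obtain T1 where T1: "subseq T1 T" "trim \<epsilon> u (map fst T @ [e]) = map fst T1 @ [e]"
      "total_reduction T - \<epsilon> * r \<le> total_reduction T1"
    using trim_total_reduction_ge[OF assms, of u] e by auto
  have "charged \<epsilon> \<phi> (T1 @ [(e, r)])"
    using assms(1)
    by (intro charged_subseq[OF _ assms(3)]) (simp_all add: T1(1) list_emb_append_mono)
  then obtain T2 where T2: "subseq T2 T1" "trim \<epsilon> v (map fst T1 @ [e]) = map fst T2 @ [e]"
      "total_reduction T1 - \<epsilon> * r \<le> total_reduction T2"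
    using trim_total_reduction_ge[OF assms(1,2) _ assms(4), of T1 e r v thesis] e by auto
  show ?thesis
  proof (rule that)
    show "subseq T2 T" using T2(1) T1(1) by (rule subseq_order.trans)
    show "trim_ends \<epsilon> e (map fst T @ [e]) = map fst T2 @ [e]" using T1(2) T2(2) e by simp
    show "total_reduction T - 2 * \<epsilon> * r \<le> total_reduction T2" using T1(3) T2(3) by simp
  qed
qed

section \<open>The run of the algorithm\<close>

abbreviation potential :: "real \<Rightarrow> 'v wedge list \<Rightarrow> 'v \<Rightarrow> real" where
  "potential \<epsilon> S \<equiv> pot (ps_run \<epsilon> S)"

definition pushed :: "real \<Rightarrow> 'v wedge list \<Rightarrow> 'v wedge \<Rightarrow> bool" where
  "pushed \<epsilon> S e \<longleftrightarrow> (1 + \<epsilon>) * sum (potential \<epsilon> S) (ends e) \<le> wt e"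

definition reduced_weight :: "real \<Rightarrow> 'v wedge list \<Rightarrow> 'v wedge \<Rightarrow> real" where
  "reduced_weight \<epsilon> S e = (if pushed \<epsilon> S e then wt e - sum (potential \<epsilon> S) (ends e) else 0)"

definition pushes :: "real \<Rightarrow> 'v wedge list \<Rightarrow> ('v wedge \<times> real) list" where
  "pushes \<epsilon> S = map (\<lambda>i. (S ! i, reduced_weight \<epsilon> (take i S) (S ! i)))
     (filter (\<lambda>i. pushed \<epsilon> (take i S) (S ! i)) [0..<length S])"

lemma is_stream_append [simp]: "is_stream (S @ S') \<longleftrightarrow> is_stream S \<and> is_stream S'"
  by (simp add: is_stream_def ball_Un)

lemma ps_run_snoc: "ps_run \<epsilon> (S @ [e]) = ps_step \<epsilon> (ps_run \<epsilon> S) e"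
  by (simp add: ps_run_def)

lemma ps_run_Nil [simp]: "ps_run \<epsilon> [] = \<lparr>pot = (\<lambda>_. 0), stack = [], rweights = []\<rparr>"
  by (simp add: ps_run_def ps_init_def)

lemma reduced_total_Nil [simp]: "reduced_total \<epsilon> [] = 0"
  by (simp add: reduced_total_def)

lemma pushes_Nil [simp]: "pushes \<epsilon> [] = []"
  by (simp add: pushes_def)

lemma ps_step_eq:
  assumes "is_stream [e]"
  shows "ps_step \<epsilon> (ps_run \<epsilon> S) e =
    \<lparr>pot = raise (e, reduced_weight \<epsilon> S e) (potential \<epsilon> S),
     stack = trim_ends \<epsilon> e (stack (ps_run \<epsilon> S) @ (if pushed \<epsilon> S e then [e] else [])),
     rweights = rweights (ps_run \<epsilon> S) @ [reduced_weight \<epsilon> S e]\<rparr>"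
proof -
  obtain u v w where e: "e = (u, v, w)" "u \<noteq> v"
    using assms by (cases e) (auto simp: is_stream_def)
  then show ?thesis
    by (auto simp: Let_def fun_eq_iff raise_def pushed_def reduced_weight_def)
qed

lemma potential_snoc:
  "is_stream [e] \<Longrightarrow> potential \<epsilon> (S @ [e]) = raise (e, reduced_weight \<epsilon> S e) (potential \<epsilon> S)"
  by (simp add: ps_run_snoc ps_step_eq)

lemma stack_snoc:
  "is_stream [e] \<Longrightarrow> stack (ps_run \<epsilon> (S @ [e])) =
     trim_ends \<epsilon> e (stack (ps_run \<epsilon> S) @ (if pushed \<epsilon> S e then [e] else []))"
  by (simp add: ps_run_snoc ps_step_eq)

lemma reduced_total_snoc:
  "is_stream [e] \<Longrightarrow> reduced_total \<epsilon> (S @ [e]) = reduced_total \<epsilon> S + reduced_weight \<epsilon> S e"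
  by (simp add: reduced_total_def ps_run_snoc ps_step_eq)

lemma pushes_snoc:
  "pushes \<epsilon> (S @ [e]) = pushes \<epsilon> S @ (if pushed \<epsilon> S e then [(e, reduced_weight \<epsilon> S e)] else [])"
proof -
  have "filter (\<lambda>i. pushed \<epsilon> (take i (S @ [e])) ((S @ [e]) ! i)) [0..<length S] =
      filter (\<lambda>i. pushed \<epsilon> (take i S) (S ! i)) [0..<length S]"
    by (intro filter_cong) (simp_all add: nth_append)
  then show ?thesis by (simp add: pushes_def nth_append)
qed

lemma fst_set_pushes: "fst ` set (pushes \<epsilon> S) \<subseteq> set S"
  by (auto simp: pushes_def)

lemma potential_eq_fold_pushes:
  assumes "is_stream S"
  shows "potential \<epsilon> S = fold raise (pushes \<epsilon> S) (\<lambda>_. 0)"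
  using assms
proof (induction S rule: rev_induct)
  case (snoc e S)
  then show ?case
    by (auto simp: potential_snoc pushes_snoc fun_eq_iff raise_def reduced_weight_def)
qed simp

lemma reduced_total_eq_total_pushes:
  assumes "is_stream S"
  shows "reduced_total \<epsilon> S = total_reduction (pushes \<epsilon> S)"
  using assms
proof (induction S rule: rev_induct)
  case (snoc e S)
  then show ?case by (simp add: reduced_total_snoc pushes_snoc reduced_weight_def)
qed simp


lemma reduced_weight_ge:
  "pushed \<epsilon> S e \<Longrightarrow> \<epsilon> * sum (potential \<epsilon> S) (ends e) \<le> reduced_weight \<epsilon> S e"
  by (simp add: pushed_def reduced_weight_def algebra_simps)

lemma reduced_weight_nonneg_if_potential_nonneg:
  assumes "0 \<le> \<epsilon>" "(\<lambda>_. 0) \<le> potential \<epsilon> S"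
  shows "0 \<le> reduced_weight \<epsilon> S e"
proof (cases "pushed \<epsilon> S e")
  case True
  have "0 \<le> \<epsilon> * sum (potential \<epsilon> S) (ends e)"
    using assms by (intro mult_nonneg_nonneg sum_nonneg) (auto simp: le_fun_def)
  also have "\<dots> \<le> reduced_weight \<epsilon> S e" using True by (rule reduced_weight_ge)
  finally show ?thesis .
qed (simp add: reduced_weight_def)

lemma potential_nonneg:
  assumes "0 \<le> \<epsilon>" "is_stream S"
  shows "(\<lambda>_. 0) \<le> potential \<epsilon> S"
  using assms(2)
proof (induction S rule: rev_induct)
  case (snoc e S)
  have "(\<lambda>_. 0) \<le> potential \<epsilon> S" using snoc by simp
  also have "\<dots> \<le> raise (e, reduced_weight \<epsilon> S e) (potential \<epsilon> S)"
    using reduced_weight_nonneg_if_potential_nonneg[OF assms(1) calculation]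
    by (simp add: le_raise)
  finally show ?case using snoc.prems by (simp add: potential_snoc)
qed simp

lemma reduced_weight_nonneg: "0 \<le> \<epsilon> \<Longrightarrow> is_stream S \<Longrightarrow> 0 \<le> reduced_weight \<epsilon> S e"
  by (simp add: reduced_weight_nonneg_if_potential_nonneg potential_nonneg)

lemma potential_mono:
  assumes "0 \<le> \<epsilon>" "is_stream (S @ S')"
  shows "potential \<epsilon> S \<le> potential \<epsilon> (S @ S')"
  using assms(2)
proof (induction S' rule: rev_induct)
  case (snoc e S')
  have "potential \<epsilon> S \<le> potential \<epsilon> (S @ S')" using snoc by simp
  also have "\<dots> \<le> raise (e, reduced_weight \<epsilon> (S @ S') e) (potential \<epsilon> (S @ S'))"
    using snoc.prems assms(1) by (intro le_raise) (simp add: reduced_weight_nonneg)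
  also have "\<dots> = potential \<epsilon> (S @ S' @ [e])"
    using snoc.prems potential_snoc[of e \<epsilon> "S @ S'"] by simp
  finally show ?case .
qed simp

lemma reduced_total_mono:
  assumes "0 \<le> \<epsilon>" "is_stream (S @ S')"
  shows "reduced_total \<epsilon> S \<le> reduced_total \<epsilon> (S @ S')"
  using assms(2)
proof (induction S' rule: rev_induct)
  case (snoc e S')
  then show ?case
    using reduced_total_snoc[of e \<epsilon> "S @ S'"] reduced_weight_nonneg[OF assms(1), of "S @ S'" e]
    by simp
qed simp

lemma reduced_total_nonneg: "0 \<le> \<epsilon> \<Longrightarrow> is_stream S \<Longrightarrow> 0 \<le> reduced_total \<epsilon> S"
  using reduced_total_mono[of \<epsilon> "[]" S] by simp

lemma charged_pushes:
  assumes "0 \<le> \<epsilon>" "is_stream S"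
  shows "charged \<epsilon> (\<lambda>_. 0) (pushes \<epsilon> S)"
  using assms(2)
proof (induction S rule: rev_induct)
  case (snoc e S)
  have S: "is_stream S" "charged \<epsilon> (\<lambda>_. 0) (pushes \<epsilon> S)" using snoc by auto
  then show ?case
    using reduced_weight_ge[of \<epsilon> S e] reduced_weight_nonneg[OF assms(1) S(1), of e]
    by (auto simp: pushes_snoc charged_append reduced_weight_def
        simp flip: potential_eq_fold_pushes)
qed simp

lemma sum_potential_le:
  assumes "0 \<le> \<epsilon>" "is_stream S" "finite X"
  shows "sum (potential \<epsilon> S) X \<le> 2 * reduced_total \<epsilon> S"
  unfolding potential_eq_fold_pushes[OF assms(2)] reduced_total_eq_total_pushes[OF assms(2)]
  by (intro sum_fold_raise_le_total_reduction charged_nonneg[OF charged_pushes] assms)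

lemma sum_potential_le_scaled:
  assumes "0 \<le> \<epsilon>" "is_stream S"
  shows "sum (potential \<epsilon> S) X \<le> (1 + \<epsilon>) * sum (potential \<epsilon> S) X"
  using potential_nonneg[OF assms] assms(1) by (simp add: distrib_right sum_nonneg le_fun_def)

lemma wt_le_potential:
  assumes "0 \<le> \<epsilon>" "is_stream S" "e \<in> set S"
  shows "wt e \<le> (1 + \<epsilon>) * sum (potential \<epsilon> S) (ends e)"
proof -
  obtain S1 S2 where S: "S = (S1 @ [e]) @ S2" using split_list[OF assms(3)] by auto
  from assms(2) have stream: "is_stream S1" "is_stream [e]" "is_stream (S1 @ [e])"
    unfolding S is_stream_append by simp_all
  define r where "r = reduced_weight \<epsilon> S1 e"
  have r: "0 \<le> r" using assms(1) stream(1) by (simp add: r_def reduced_weight_nonneg)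
  have after_e: "sum (potential \<epsilon> (S1 @ [e])) (ends e)
      = sum (potential \<epsilon> S1) (ends e) + r * card (ends e)"
    using stream(2) by (simp add: potential_snoc sum_raise r_def)
  have "wt e \<le> (1 + \<epsilon>) * sum (potential \<epsilon> (S1 @ [e])) (ends e)"
  proof (cases "pushed \<epsilon> S1 e")
    case True
    have "r \<le> r * card (ends e)" using r by (simp add: le_mult_card ends_nonempty)
    then have "wt e \<le> sum (potential \<epsilon> (S1 @ [e])) (ends e)"
      using True after_e by (simp add: r_def reduced_weight_def)
    also have "\<dots> \<le> (1 + \<epsilon>) * sum (potential \<epsilon> (S1 @ [e])) (ends e)"
      using assms(1) stream(3) by (rule sum_potential_le_scaled)
    finally show ?thesis .
  next
    case False
    then show ?thesis using after_e by (simp add: r_def reduced_weight_def pushed_def)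
  qed
  also have "\<dots> \<le> (1 + \<epsilon>) * sum (potential \<epsilon> S) (ends e)"
    using potential_mono[of \<epsilon> "S1 @ [e]" S2] S assms
    by (intro mult_left_mono sum_mono) (auto simp: le_fun_def)
  finally show ?thesis .
qed

lemma matching_weight_le_potential:
  assumes "0 \<le> \<epsilon>" "is_stream S" "M \<subseteq> set S" "is_matching M"
  shows "weight M \<le> (1 + \<epsilon>) * sum (potential \<epsilon> S) (verts M)"
proof -
  have "weight M \<le> (\<Sum>e\<in>M. (1 + \<epsilon>) * sum (potential \<epsilon> S) (ends e))"
    unfolding weight_def using assms by (intro sum_mono wt_le_potential) auto
  also have "\<dots> = (1 + \<epsilon>) * sum (potential \<epsilon> S) (verts M)"
    using assms(3,4) finite_subset
    by (subst sum_verts_matching) (auto simp: sum_distrib_left)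
  finally show ?thesis .
qed

section \<open>The output matching\<close>

lemma degree_stack:
  assumes "0 < \<epsilon>" "\<epsilon> \<le> 1"
  shows "is_stream S \<Longrightarrow> real (degree x (stack (ps_run \<epsilon> S))) \<le> max_degree \<epsilon>"
proof (induction S rule: rev_induct)
  case Nil
  show ?case using max_degree_ge_1[OF assms] by simp
next
  case (snoc e S)
  let ?st = "stack (ps_run \<epsilon> S) @ (if pushed \<epsilon> S e then [e] else [])"
  have IH: "real (degree x (stack (ps_run \<epsilon> S))) \<le> max_degree \<epsilon>" using snoc by simp
  have "real (degree x (trim_ends \<epsilon> e ?st)) \<le> max_degree \<epsilon>"
  proof (cases "x \<in> ends e")
    case True
    then show ?thesis using IH by (intro degree_trim_ends assms) auto
  next
    case False
    then have "degree x (trim_ends \<epsilon> e ?st) \<le> degree x (stack (ps_run \<epsilon> S))"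
      using degree_trim_ends_le[OF assms, of x e ?st] by (simp split: if_splits)
    then show ?thesis using IH by linarith
  qed
  then show ?case using snoc.prems by (simp add: stack_snoc)
qed

lemma stack_retains_weight:
  assumes "0 < \<epsilon>" "\<epsilon> \<le> 1 / 4" "is_stream S"
  shows "\<exists>T. subseq T (pushes \<epsilon> S) \<and> stack (ps_run \<epsilon> S) = map fst T \<and>
           (1 - 2 * \<epsilon>) * reduced_total \<epsilon> S \<le> total_reduction T"
  using assms(3)
proof (induction S rule: rev_induct)
  case (snoc e S)
  define r where "r = reduced_weight \<epsilon> S e"
  have S: "is_stream S" "is_stream [e]" using snoc.prems by auto
  obtain T where T: "subseq T (pushes \<epsilon> S)" "stack (ps_run \<epsilon> S) = map fst T"
      "(1 - 2 * \<epsilon>) * reduced_total \<epsilon> S \<le> total_reduction T"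
    using snoc.IH S(1) by blast
  show ?case
  proof (cases "pushed \<epsilon> S e")
    case True
    have pushes: "pushes \<epsilon> (S @ [e]) = pushes \<epsilon> S @ [(e, r)]"
      using True by (simp add: pushes_snoc r_def)
    have "subseq (T @ [(e, r)]) (pushes \<epsilon> (S @ [e]))"
      using T(1) by (simp add: pushes list_emb_append_mono)
    then have "charged \<epsilon> (\<lambda>_. 0) (T @ [(e, r)])"
      by (rule charged_subseq) (use assms(1) snoc.prems in \<open>simp_all add: charged_pushes\<close>)
    from trim_ends_total_reduction_ge[OF assms(1,2) this order_refl]
    obtain T' where T': "subseq T' T" "trim_ends \<epsilon> e (map fst T @ [e]) = map fst T' @ [e]"
        "total_reduction T - 2 * \<epsilon> * r \<le> total_reduction T'" .
    have "subseq (T' @ [(e, r)]) (pushes \<epsilon> (S @ [e]))"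
      using subseq_order.trans[OF T'(1) T(1)] by (simp add: pushes list_emb_append_mono)
    moreover have "stack (ps_run \<epsilon> (S @ [e])) = map fst (T' @ [(e, r)])"
      using True S(2) T(2) T'(2) by (simp add: stack_snoc)
    moreover have "(1 - 2 * \<epsilon>) * reduced_total \<epsilon> (S @ [e]) \<le> total_reduction (T' @ [(e, r)])"
      using S(2) T(3) T'(3) by (simp add: reduced_total_snoc r_def algebra_simps)
    ultimately show ?thesis by blast
  next
    case False
    have "trim_ends \<epsilon> e (stack (ps_run \<epsilon> S)) = stack (ps_run \<epsilon> S)"
      using degree_stack[OF _ _ S(1)] assms(1,2) by (intro trim_ends_idle) simp
    then show ?thesis
      using False S(2) T
      by (auto simp: stack_snoc pushes_snoc reduced_total_snoc reduced_weight_def)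
  qed
qed simp

lemma ps_matching_eq_greedy: "ps_matching \<epsilon> S = greedy (stack (ps_run \<epsilon> S))"
  by (simp add: ps_matching_def greedy_def)

lemma is_matching_ps_matching: "is_matching (ps_matching \<epsilon> S)"
  by (simp add: ps_matching_eq_greedy is_matching_greedy)

lemma ps_matching_subset:
  assumes "0 < \<epsilon>" "\<epsilon> \<le> 1 / 4" "is_stream S"
  shows "ps_matching \<epsilon> S \<subseteq> set S"
proof -
  obtain T where T: "subseq T (pushes \<epsilon> S)" "stack (ps_run \<epsilon> S) = map fst T"
    using stack_retains_weight[OF assms] by blast
  have "ps_matching \<epsilon> S \<subseteq> fst ` set T"
    using greedy_subset[of "map fst T"] by (simp add: ps_matching_eq_greedy T(2))
  also have "\<dots> \<subseteq> fst ` set (pushes \<epsilon> S)"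
    using list_emb_set[OF T(1)] by (intro image_mono) blast
  also have "\<dots> \<subseteq> set S" by (rule fst_set_pushes)
  finally show ?thesis .
qed

lemma ps_matching_weight:
  assumes "0 < \<epsilon>" "\<epsilon> \<le> 1 / 4" "is_stream S"
  shows "(1 - 2 * \<epsilon>) * reduced_total \<epsilon> S \<le> weight (ps_matching \<epsilon> S)"
proof -
  obtain T where T: "subseq T (pushes \<epsilon> S)" "stack (ps_run \<epsilon> S) = map fst T"
      "(1 - 2 * \<epsilon>) * reduced_total \<epsilon> S \<le> total_reduction T"
    using stack_retains_weight[OF assms] by blast
  have "charged \<epsilon> (\<lambda>_. 0) T"
    using charged_subseq[OF T(1) charged_pushes] assms by simp
  then have "total_reduction T \<le> weight (greedy (map fst T))"
    using charged_greedy_weight by fastforce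
  with T show ?thesis by (simp add: ps_matching_eq_greedy)
qed

section \<open>Bounds on the maximum weight\<close>

lemma obtain_matching_avoiding:
  assumes "0 \<le> \<epsilon>" "is_stream S" "finite X"
  obtains M where "M \<subseteq> set S" "is_matching M" "verts M \<inter> X = {}"
    "reduced_total \<epsilon> S - sum (potential \<epsilon> S) X \<le> weight M"
proof -
  define T where "T = filter (\<lambda>(e, r). ends e \<inter> X = {}) (pushes \<epsilon> S)"
  define M where "M = greedy (map fst T)"
  have M_T: "M \<subseteq> fst ` set T" using greedy_subset[of "map fst T"] by (simp add: M_def)
  have charged: "charged \<epsilon> (\<lambda>_. 0) (pushes \<epsilon> S)" using assms(1,2) by (rule charged_pushes)
  show ?thesis
  proof (rule that)
    show "M \<subseteq> set S" using M_T fst_set_pushes[of \<epsilon> S] by (auto simp: T_def)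
    show "is_matching M" by (simp add: M_def is_matching_greedy)
    have "ends e \<inter> X = {}" if "e \<in> M" for e
      using M_T that by (force simp: T_def)
    then show "verts M \<inter> X = {}" by blast
    have "reduced_total \<epsilon> S \<le> total_reduction T + sum (potential \<epsilon> S) X"
      unfolding T_def reduced_total_eq_total_pushes[OF assms(2)]
        potential_eq_fold_pushes[OF assms(2)]
      by (rule total_reduction_le_avoiding[OF assms(3) charged_nonneg[OF charged]])
    moreover have "charged \<epsilon> (\<lambda>_. 0) T"
      unfolding T_def by (rule charged_subseq[OF subseq_filter_left charged assms(1)])
    then have "total_reduction T \<le> weight M"
      using charged_greedy_weight unfolding M_def by fastforce
    ultimately show "reduced_total \<epsilon> S - sum (potential \<epsilon> S) X \<le> weight M" by linarith
  qed
qed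

lemma reduced_total_le_MWM:
  assumes "0 \<le> \<epsilon>" "is_stream S"
  shows "reduced_total \<epsilon> S \<le> MWM S"
proof -
  obtain M where "M \<subseteq> set S" "is_matching M" "reduced_total \<epsilon> S \<le> weight M"
    using obtain_matching_avoiding[OF assms, of "{}"] by auto
  then show ?thesis using weight_le_MWM order.trans by blast
qed

lemma MWM_le_reduced_total:
  assumes "0 \<le> \<epsilon>" "is_stream S"
  shows "MWM S \<le> (2 + 2 * \<epsilon>) * reduced_total \<epsilon> S"
proof (rule MWM_le)
  fix M assume M: "M \<subseteq> set S" "is_matching M"
  have "finite (verts M)" using M(1) by (rule finite_verts)
  have "weight M \<le> (1 + \<epsilon>) * sum (potential \<epsilon> S) (verts M)"
    using assms M by (rule matching_weight_le_potential)
  also have "\<dots> \<le> (1 + \<epsilon>) * (2 * reduced_total \<epsilon> S)"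
    using assms \<open>finite (verts M)\<close> by (intro mult_left_mono sum_potential_le) auto
  finally show "weight M \<le> (2 + 2 * \<epsilon>) * reduced_total \<epsilon> S" by (simp add: algebra_simps)
qed

lemma sum_potential_append_le:
  assumes "0 \<le> \<epsilon>" "is_stream (A @ B)" "finite X"
  shows "(1 + \<epsilon>) * sum (potential \<epsilon> (A @ B)) X
           \<le> 2 * (1 + \<epsilon>) * reduced_total \<epsilon> (A @ B) - reduced_total \<epsilon> B + sum (potential \<epsilon> B) X"
proof -
  let ?\<phi> = "potential \<epsilon> (A @ B)"
  have "is_stream B" using assms(2) by simp
  from obtain_matching_avoiding[OF assms(1) this assms(3)] obtain M
    where M: "M \<subseteq> set B" "is_matching M" "verts M \<inter> X = {}"
      and weight: "reduced_total \<epsilon> B - sum (potential \<epsilon> B) X \<le> weight M" .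
  have finite: "finite (verts M)" using M(1) by (rule finite_verts)
  have "weight M \<le> (1 + \<epsilon>) * sum ?\<phi> (verts M)"
    using M assms by (intro matching_weight_le_potential) auto
  moreover have "(1 + \<epsilon>) * (sum ?\<phi> (verts M) + sum ?\<phi> X) \<le> (1 + \<epsilon>) * (2 * reduced_total \<epsilon> (A @ B))"
    using sum_potential_le[OF assms(1,2), of "verts M \<union> X"] finite assms(1,3) M(3)
    by (intro mult_left_mono) (auto simp: sum.union_disjoint)
  ultimately show ?thesis using weight by (simp add: algebra_simps)
qed

lemma matching_weight_le_prefix_middle:
  assumes "0 \<le> \<epsilon>" "is_stream (A @ B @ C)" "L \<subseteq> set (A @ B)" "is_matching L"
  shows "weight L \<le> 2 * (1 + \<epsilon>) * reduced_total \<epsilon> (A @ B) - reduced_total \<epsilon> B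
           + (1 + \<epsilon>) * sum (potential \<epsilon> (B @ C)) (verts L)"
proof -
  let ?\<phi> = "potential \<epsilon> (B @ C)"
  have stream: "is_stream (A @ B)" "is_stream (B @ C)" using assms(2) by auto
  have "weight L \<le> (1 + \<epsilon>) * sum (potential \<epsilon> (A @ B)) (verts L)"
    using assms(1) stream(1) assms(3,4) by (rule matching_weight_le_potential)
  also have "\<dots> \<le> 2 * (1 + \<epsilon>) * reduced_total \<epsilon> (A @ B) - reduced_total \<epsilon> B
      + sum (potential \<epsilon> B) (verts L)"
    using assms(1) stream(1) finite_verts[OF assms(3)] by (rule sum_potential_append_le)
  also have "sum (potential \<epsilon> B) (verts L) \<le> sum ?\<phi> (verts L)"
    using potential_mono[OF assms(1) stream(2)] by (intro sum_mono) (simp add: le_fun_def)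
  also have "\<dots> \<le> (1 + \<epsilon>) * sum ?\<phi> (verts L)"
    using assms(1) stream(2) by (rule sum_potential_le_scaled)
  finally show ?thesis by simp
qed

lemma MWM_le_overlapping_reduced_totals:
  assumes "0 \<le> \<epsilon>" "is_stream (A @ B @ C)"
  shows "MWM (A @ B @ C) \<le> 2 * (1 + \<epsilon>) * reduced_total \<epsilon> (A @ B) - reduced_total \<epsilon> B
           + 2 * (1 + \<epsilon>) * reduced_total \<epsilon> (B @ C)"
proof (rule MWM_le)
  fix M assume M: "M \<subseteq> set (A @ B @ C)" "is_matching M"
  have BC: "is_stream (B @ C)" using assms(2) by simp
  define L where "L = M - set (B @ C)"
  define N where "N = M \<inter> set (B @ C)"
  let ?\<phi> = "potential \<epsilon> (B @ C)"
  have subset: "L \<subseteq> set (A @ B)" "N \<subseteq> set (B @ C)" using M(1) by (auto simp: L_def N_def)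
  have matching: "is_matching L" "is_matching N"
    using M(2) by (auto simp: L_def N_def intro: is_matching_subset)
  have disjoint: "verts L \<inter> verts N = {}"
    using M(2) by (rule is_matching_verts_disjoint) (auto simp: L_def N_def)
  have "finite M" using M(1) finite_subset by blast
  then have "weight M = weight L + weight N"
    unfolding weight_def L_def N_def using sum.Int_Diff[of M] by (simp add: add.commute)
  moreover have "weight L \<le> 2 * (1 + \<epsilon>) * reduced_total \<epsilon> (A @ B) - reduced_total \<epsilon> B
      + (1 + \<epsilon>) * sum ?\<phi> (verts L)"
    using assms subset(1) matching(1) by (rule matching_weight_le_prefix_middle)
  moreover have "weight N \<le> (1 + \<epsilon>) * sum ?\<phi> (verts N)"
    using assms(1) BC subset(2) matching(2) by (rule matching_weight_le_potential)
  moreover have "(1 + \<epsilon>) * (sum ?\<phi> (verts L) + sum ?\<phi> (verts N))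
      \<le> (1 + \<epsilon>) * (2 * reduced_total \<epsilon> (B @ C))"
    using sum_potential_le[OF assms(1) BC, of "verts L \<union> verts N"] assms(1) disjoint
      finite_verts[OF subset(1)] finite_verts[OF subset(2)]
    by (intro mult_left_mono) (simp_all add: sum.union_disjoint)
  ultimately show "weight M \<le> 2 * (1 + \<epsilon>) * reduced_total \<epsilon> (A @ B) - reduced_total \<epsilon> B
      + 2 * (1 + \<epsilon>) * reduced_total \<epsilon> (B @ C)"
    by (simp add: algebra_simps)
qed

lemma MWM_le_reduced_total_lookahead:
  assumes "0 \<le> \<epsilon>" "\<epsilon> \<le> 1" "\<beta> \<le> \<epsilon> / 9" "is_stream (A @ B @ C)"
    and "(1 - \<beta>) * reduced_total \<epsilon> (A @ B) \<le> reduced_total \<epsilon> B"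
  shows "MWM (A @ B @ C) \<le> (3 + 5 * \<epsilon>) * reduced_total \<epsilon> (B @ C)"
proof -
  let ?a = "reduced_total \<epsilon> (A @ B)" and ?b = "reduced_total \<epsilon> B" and ?c = "reduced_total \<epsilon> (B @ C)"
  have stream: "is_stream (A @ B)" "is_stream (B @ C)" using assms(4) by auto
  have "(2 + 3 * \<epsilon>) * \<beta> \<le> (2 + 3 * \<epsilon>) * (\<epsilon> / 9)"
    using assms(1,3) by (intro mult_left_mono) auto
  also have "\<dots> \<le> 9 * (\<epsilon> / 9)" using assms(1,2) by (intro mult_right_mono) auto
  finally have "2 * (1 + \<epsilon>) \<le> (2 + 3 * \<epsilon>) * (1 - \<beta>)" by (simp add: algebra_simps)
  then have "2 * (1 + \<epsilon>) * ?a \<le> (2 + 3 * \<epsilon>) * (1 - \<beta>) * ?a"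
    using reduced_total_nonneg[OF assms(1) stream(1)] by (rule mult_right_mono)
  also have "\<dots> \<le> (2 + 3 * \<epsilon>) * ?b"
    using assms(1,5) by (simp add: mult.assoc mult_left_mono)
  finally have "2 * (1 + \<epsilon>) * ?a - ?b \<le> (1 + 3 * \<epsilon>) * ?b" by (simp add: algebra_simps)
  also have "\<dots> \<le> (1 + 3 * \<epsilon>) * ?c"
    using reduced_total_mono[OF assms(1) stream(2)] assms(1) by (intro mult_left_mono) auto
  finally have "2 * (1 + \<epsilon>) * ?a - ?b + 2 * (1 + \<epsilon>) * ?c \<le> (3 + 5 * \<epsilon>) * ?c"
    by (simp add: algebra_simps)
  with MWM_le_overlapping_reduced_totals[OF assms(1,4)] show ?thesis by linarith
qed

lemma reduced_total_le_ps_matching_weight: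
  assumes "0 < \<epsilon>" "\<epsilon> \<le> 1 / 10" "is_stream S"
  shows "(3 + 5 * \<epsilon>) * reduced_total \<epsilon> S \<le> (3 + 20 * \<epsilon>) * weight (ps_matching \<epsilon> S)"
proof -
  have "3 + 5 * \<epsilon> \<le> (3 + 20 * \<epsilon>) * (1 - 2 * \<epsilon>)"
    using mult_right_mono[OF assms(2), of \<epsilon>] assms(1) by (simp add: algebra_simps)
  then have "(3 + 5 * \<epsilon>) * reduced_total \<epsilon> S \<le> (3 + 20 * \<epsilon>) * (1 - 2 * \<epsilon>) * reduced_total \<epsilon> S"
    using reduced_total_nonneg[of \<epsilon> S] assms by (intro mult_right_mono) auto
  also have "\<dots> \<le> (3 + 20 * \<epsilon>) * weight (ps_matching \<epsilon> S)"
    using ps_matching_weight[of \<epsilon> S] assms by (simp add: mult.assoc mult_left_mono)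
  finally show ?thesis .
qed

theorem theorem8:
  fixes \<epsilon> \<beta> :: real
  assumes "0 < \<epsilon>" and "\<epsilon> \<le> 1 / 10"
    and "0 < \<beta>" and "\<beta> \<le> \<epsilon> / 9"
  shows "refined_lookahead (is_stream :: 'v wedge list \<Rightarrow> bool) MWM (2 + 2 * \<epsilon>) (3 + 20 * \<epsilon>) \<beta>
           (reduced_total \<epsilon>) (\<lambda>S. weight (ps_matching \<epsilon> S))"
  unfolding refined_lookahead_def
proof (intro allI impI conjI; (elim conjE)?)
  have \<epsilon>: "0 \<le> \<epsilon>" "\<epsilon> \<le> 1 / 4" "\<epsilon> \<le> 1" using assms(1,2) by auto
  fix S :: "'v wedge list" assume S: "is_stream S"
  show "reduced_total \<epsilon> S \<le> MWM S" using \<epsilon>(1) S by (rule reduced_total_le_MWM)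
  show "MWM S \<le> (2 + 2 * \<epsilon>) * reduced_total \<epsilon> S" using \<epsilon>(1) S by (rule MWM_le_reduced_total)
  fix A B C assume ABC: "S = A @ B @ C"
    and lookahead: "(1 - \<beta>) * reduced_total \<epsilon> (A @ B) \<le> reduced_total \<epsilon> B"
  have BC: "is_stream (B @ C)" using S ABC by simp
  show "weight (ps_matching \<epsilon> (B @ C)) \<le> MWM (A @ B @ C)"
    using ps_matching_subset[OF assms(1) \<epsilon>(2) BC]
    by (intro weight_le_MWM is_matching_ps_matching) auto
  have "MWM (A @ B @ C) \<le> (3 + 5 * \<epsilon>) * reduced_total \<epsilon> (B @ C)"
    using \<epsilon> assms(4) S lookahead unfolding ABC by (intro MWM_le_reduced_total_lookahead)
  also have "\<dots> \<le> (3 + 20 * \<epsilon>) * weight (ps_matching \<epsilon> (B @ C))"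
    using assms(1,2) BC by (rule reduced_total_le_ps_matching_weight)
  finally show "MWM (A @ B @ C) \<le> (3 + 20 * \<epsilon>) * weight (ps_matching \<epsilon> (B @ C))" .
qed

end
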